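(* If $n\ge1$ is an integer, then $P\preccurlyeq T[P]$ for all $P\in\mathcal{H}_n$ and all $T\in\mathcal{A}'$.
   Context: $\Pi=\mathbb{C}[x]$; $\mathcal{H}_n\subset\Pi$ denotes the set of monic polynomials of degree $n$ all of whose zeros are real ($\mathcal{H}_0=\{1\}$). For a nonconstant polynomial $P$, $\mathfrak{m}(P)$ is the arithmetic mean of its zeros counted with multiplicity. $\mathcal{A}$ is the monoid of linear operators $T$ on $\Pi$ with $T(\mathcal{H}_n)\subseteq\mathcal{H}_n$ for all integers $n\ge0$, and $\mathcal{A}'=\{T\in\mathcal{A}:\mathfrak{m}(T(P))=\mathfrak{m}(P)\text{ for all }P\in\Pi\text{ with }\deg P\ge1\}$. (By a known theorem of Carnicer, Peña and Pinkus, $\mathcal{A}=\{\varphi(D):\varphi\in\mathcal{LP},\varphi(0)=1\}$, where $D=d/dx$, $\varphi(D)[P]=\sum_ka_kP^{(k)}$ for $\varphi(x)=\sum_ka_kx^k$, and $\mathcal{LP}$ is the class of real entire functions $cx^me^{-a^2x^2+bx}\prod_{k=1}^\infty(1-\alpha_kx)e^{\alpha_kx}$ with $a,b,c,\alpha_k\in\mathbb{R}$, $c\ne0$, $m$ a nonnegative integer, $\sum_k\alpha_k^2<\infty$; accordingly $\mathcal{A}'$ consists of those $\varphi(D)$ with $\varphi(0)=1$ and $\varphi$ of this form with $b=0$.) $\mathcal{Z}(P)$ is the unordered tuple of zeros of $P$ counted with multiplicity. Spectral order: for unordered real $n$-tuples $X,Y$ write $X\prec Y$ if $\sum_{i=1}^n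 f(x_i)\le\sum_{i=1}^n f(y_i)$ for every convex $f:\mathbb{R}\to\mathbb{R}$ (equivalently, $X=AY$ as column vectors for some doubly stochastic matrix $A$); for $P,Q\in\mathcal{H}_n$ write $Q\preccurlyeq P$ if $\mathcal{Z}(Q)\prec\mathcal{Z}(P)$. *)

theory Defs
  imports "HOL-Analysis.Analysis" "HOL-Computational_Algebra.Computational_Algebra"
begin

definition hyperbolic :: "nat \<Rightarrow> complex poly set" where
  "hyperbolic n = {P. lead_coeff P = 1 \<and> degree P = n \<and> (\<forall>z. poly P z = 0 \<longrightarrow> z \<in> \<real>)}"

lemma hyperbolic_0: "hyperbolic 0 = {1}"
  by (auto simp: hyperbolic_def elim!: degree_eq_zeroE)

text \<open>
  Only meaningful for nonconstant \<open>P\<close>; over the complex numbers the size of \<^term>\<open>proots P\<close>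
  is the degree of \<open>P\<close>.
\<close>
definition zeros_mean :: "complex poly \<Rightarrow> complex" where
  "zeros_mean P = (\<Sum>z\<in>#proots P. z) / of_nat (size (proots P))"

definition hyperbolic_preservers :: "(complex poly \<Rightarrow> complex poly) set" where
  "hyperbolic_preservers =
     {T. Vector_Spaces.linear smult smult T \<and> (\<forall>n. T ` hyperbolic n \<subseteq> hyperbolic n)}"

text \<open>
  Elements of \<^const>\<open>hyperbolic_preservers\<close> are linear and map monic polynomials \<open>x ^ n\<close> to
  monic polynomials of the same degree, hence preserve degrees; so the mean of the zeros of
  \<open>T P\<close> below is never taken for a constant.
\<close>
definition mean_preservers :: "(complex poly \<Rightarrow> complex poly) set" where
  "mean_preservers =
     {T \<in> hyperbolic_preservers. \<forall>P. degree P \<ge> 1 \<longrightarrow> zeros_mean (T P) = zeros_mean P}"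

text \<open>Unordered tuples are multisets.\<close>
definition spectral_le :: "real multiset \<Rightarrow> real multiset \<Rightarrow> bool" where
  "spectral_le X Y \<longleftrightarrow> size X = size Y \<and>
     (\<forall>f. convex_on UNIV f \<longrightarrow> (\<Sum>x\<in>#X. f x) \<le> (\<Sum>y\<in>#Y. f y))"

text \<open>
  The zeros of members of \<^term>\<open>hyperbolic n\<close> are real complex numbers, so \<^const>\<open>Re\<close> merely
  converts their type.
\<close>
definition poly_spectral_le :: "nat \<Rightarrow> complex poly \<Rightarrow> complex poly \<Rightarrow> bool" where
  "poly_spectral_le n Q P \<longleftrightarrow> Q \<in> hyperbolic n \<and> P \<in> hyperbolic n \<and>
     spectral_le (image_mset Re (proots Q)) (image_mset Re (proots P))"

end

(*
  An operator T in the theorem commutes with D, so T = sum_k a_k D^k.  If T x^m = prod (x - b_i),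
  then all b_i are real with sum 0, and the operators prod (1 - (b_i / m) D) converge to T
  as m -> infinity, because m! / ((m - k)! m^k) -> 1.
  It remains to treat 1 - alpha D.  The zeros of P - alpha P' are the eigenvalues of the symmetric
  matrix diag(x_1, ..., x_n) + alpha J, with J the all-ones matrix and x_i the zeros of P.  The
  diagonal entries are x_i + alpha, so Schur's theorem on diagonals and eigenvalues shows that
  the zeros of P shifted by alpha are majorized by those of P - alpha P'; the shifts add up to 0.
*)
theory Submission
  imports Defs
begin

text \<open>An eigenvector v of diag(x_1, ..., x_n) + alpha J for the eigenvalue r satisfies (r -
  x_i) v_i = alpha (v_1 + ... + v_n), so its entries are proportional to 1 / (r - x_i). The doubly
  stochastic matrix in Schur's theorem, made of squared normalized entries, is therefore rational in
  the zeros, and its row sums and row means follow from Lagrange interpolation at the zeros of P -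
  alpha P'. This requires simple zeros; multiple ones are reached in the limit. Limits respect the
  order because a convex function on the reals is continuous and pointwise convergence of monic
  polynomials of fixed degree keeps their real zeros bounded.

  The symbol prod (1 - (b_i / m) x) is T x^m with its coefficients reversed and x replaced by x / m;
  its k-th coefficient is a_k m! / ((m - k)! m^k).

  Commuting with D is not part of the definition of T. It comes from a rigidity of real zeros: two
  coefficients determine the sum of their squares, and this sum bounds the polynomial at 0.\<close>

section \<open>Partial fractions and Lagrange interpolation at simple roots\<close>

definition node_poly :: "'a::field set \<Rightarrow> 'a poly" where
  "node_poly S = (\<Prod>s\<in>S. [:- s, 1:])"

lemma poly_node_poly: "poly (node_poly S) t = (\<Prod>s\<in>S. t - s)"
  by (simp add: node_poly_def poly_prod)

lemma degree_node_poly [simp]: "degree (node_poly S) = card S"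
  by (cases "finite S") (simp_all add: node_poly_def degree_prod_sum_eq)

lemma lead_coeff_node_poly: "coeff (node_poly S) (card S) = 1"
proof -
  have "lead_coeff (node_poly S) = 1"
    unfolding node_poly_def lead_coeff_prod by simp
  then show ?thesis by simp
qed

lemma node_poly_remove:
  "finite S \<Longrightarrow> s \<in> S \<Longrightarrow> node_poly S = [:- s, 1:] * node_poly (S - {s})"
  by (simp add: node_poly_def prod.remove)

lemma pderiv_node_poly: "pderiv (node_poly S) = (\<Sum>s\<in>S. node_poly (S - {s}))"
  by (simp add: node_poly_def pderiv_prod pderiv_pCons one_pCons [symmetric])

lemma poly_node_poly_eq_0_iff: "finite S \<Longrightarrow> poly (node_poly S) t = 0 \<longleftrightarrow> t \<in> S"
  by (auto simp: poly_node_poly)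

lemma poly_pderiv_node_poly:
  assumes "finite S" "s \<in> S"
  shows "poly (pderiv (node_poly S)) s = poly (node_poly (S - {s})) s"
  by (subst node_poly_remove[OF assms], subst pderiv_mult) (simp add: pderiv_pCons)

lemma poly_node_poly_Diff:
  assumes "finite S" "s \<in> S" "t \<noteq> s"
  shows "poly (node_poly (S - {s})) t = poly (node_poly S) t / (t - s)"
proof -
  have "poly (node_poly S) t = (t - s) * poly (node_poly (S - {s})) t"
    by (subst node_poly_remove[OF assms(1,2)]) (simp add: algebra_simps)
  then show ?thesis using assms by simp
qed

lemma poly_pderiv_node_poly_Diff:
  assumes "finite S" "s \<in> S" "t \<noteq> s"
  shows "poly (pderiv (node_poly (S - {s}))) t
    = (poly (pderiv (node_poly S)) t - poly (node_poly (S - {s})) t) / (t - s)"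
proof -
  have "poly (pderiv (node_poly S)) t
    = poly (node_poly (S - {s})) t + (t - s) * poly (pderiv (node_poly (S - {s}))) t"
    by (subst node_poly_remove[OF assms(1,2)], subst pderiv_mult)
      (simp add: pderiv_pCons algebra_simps)
  then show ?thesis using assms by simp
qed

text \<open>With p = \<open>node_poly S\<close>, simple roots exclude a common zero of p and p', so
  q(r) = 0 becomes the secular equation p'/p = 1/\<alpha> at r, where p'/p is the sum of the 1/(r -
  s). Differentiating p' once more gives p'' as p' times this sum minus p times the sum of the 1/(r
  - s)^2; by the secular equation only the last term survives in q'(r).\<close>

lemma node_poly_sub_pderiv_root:
  fixes S :: "'a::field set"
  assumes S: "finite S" and al: "\<alpha> \<noteq> 0"
    and q: "q = node_poly S - smult \<alpha> (pderiv (node_poly S))" and r: "poly q r = 0"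
  shows "r \<notin> S" and "\<alpha> * (\<Sum>s\<in>S. 1 / (r - s)) = 1"
    and "poly (pderiv q) r = \<alpha> * poly (node_poly S) r * (\<Sum>s\<in>S. 1 / (r - s)^2)"
proof -
  let ?p = "node_poly S"
  show rS: "r \<notin> S"
  proof
    assume "r \<in> S"
    then have "poly ?p r = 0" "poly (pderiv ?p) r \<noteq> 0"
      using S by (simp_all add: poly_node_poly_eq_0_iff poly_pderiv_node_poly)
    then show False using r al by (simp add: q)
  qed
  have p0: "poly ?p r \<noteq> 0" using rS S by (simp add: poly_node_poly_eq_0_iff)
  have dp: "poly (pderiv ?p) r = poly ?p r * (\<Sum>s\<in>S. 1 / (r - s))"
    unfolding pderiv_node_poly poly_sum sum_distrib_left
    using rS S by (intro sum.cong refl) (subst poly_node_poly_Diff, auto)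
  have "poly ?p r * (\<alpha> * (\<Sum>s\<in>S. 1 / (r - s))) = poly ?p r * 1"
    using r dp by (simp add: q mult_ac)
  then show one: "\<alpha> * (\<Sum>s\<in>S. 1 / (r - s)) = 1" using p0 mult_left_cancel by blast
  have "poly (pderiv (pderiv ?p)) r = (\<Sum>s\<in>S. poly (pderiv (node_poly (S - {s}))) r)"
    using higher_pderiv_sum[of 1 "\<lambda>s. node_poly (S - {s})" S]
    by (simp add: pderiv_node_poly[of S] poly_sum)
  also have "\<dots> = (\<Sum>s\<in>S. poly (pderiv ?p) r * (1 / (r - s)) - poly ?p r * (1 / (r - s)^2))"
  proof (intro sum.cong refl)
    fix s assume s: "s \<in> S"
    then have "r \<noteq> s" using rS by auto
    then show "poly (pderiv (node_poly (S - {s}))) r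
      = poly (pderiv ?p) r * (1 / (r - s)) - poly ?p r * (1 / (r - s)^2)"
      by (simp add: poly_node_poly_Diff[OF S s] poly_pderiv_node_poly_Diff[OF S s]
          diff_divide_distrib power2_eq_square)
  qed
  also have "\<dots> = poly (pderiv ?p) r * (\<Sum>s\<in>S. 1 / (r - s)) - poly ?p r * (\<Sum>s\<in>S. 1 / (r - s)^2)"
    by (simp only: sum_subtractf sum_distrib_left)
  finally have pp: "poly (pderiv (pderiv ?p)) r = \<dots>" .
  have "poly (pderiv q) r = poly (pderiv ?p) r
      - (\<alpha> * (\<Sum>s\<in>S. 1 / (r - s))) * poly (pderiv ?p) r + \<alpha> * poly ?p r * (\<Sum>s\<in>S. 1 / (r - s)^2)"
  proof -
    have "x - \<alpha> * (x * b - c * d) = x - (\<alpha> * b) * x + \<alpha> * c * d" for x b c d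
      by (simp add: algebra_simps)
    then show ?thesis unfolding q pderiv_diff pderiv_smult poly_diff poly_smult pp .
  qed
  then show "poly (pderiv q) r = \<alpha> * poly ?p r * (\<Sum>s\<in>S. 1 / (r - s)^2)"
    by (simp add: one)
qed

text \<open>The basis polynomial \<open>node_poly (R - {r})\<close> vanishes on R except at r, where
  its value is the derivative of \<open>node_poly R\<close>. Below degree \<open>card R\<close>,
  agreement on R suffices.\<close>

lemma lagrange_interpolation_node_poly:
  fixes R :: "'a::field set"
  assumes R: "finite R" and deg: "degree p < card R"
  shows "p = (\<Sum>r\<in>R. smult (poly p r / poly (pderiv (node_poly R)) r) (node_poly (R - {r})))"
    (is "p = ?rhs")
proof (rule poly_eqI_degree[where A = R])
  show "degree p < card R" by fact
  have "degree ?rhs \<le> card R - 1"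
    using R by (intro degree_sum_le) (auto intro: order_trans[OF degree_smult_le])
  then show "degree ?rhs < card R" using deg by simp
  fix x assume x: "x \<in> R"
  have "poly ?rhs x = (\<Sum>r\<in>R. if r = x then poly p x else 0)"
    unfolding poly_sum
  proof (intro sum.cong refl)
    fix r assume r: "r \<in> R"
    show "poly (smult (poly p r / poly (pderiv (node_poly R)) r) (node_poly (R - {r}))) x
      = (if r = x then poly p x else 0)"
      using R r x by (auto simp: poly_pderiv_node_poly poly_node_poly_eq_0_iff)
  qed
  then show "poly p x = poly ?rhs x" using x R by simp
qed

text \<open>The matrix with entries \<open>1 / ((r - s)^2 N r)\<close> is doubly stochastic: it consists of the squared
  entries of the normalized eigenvectors of \<open>diag S\<close> plus \<open>\<alpha>\<close> times the all-ones matrix, whose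
  characteristic polynomial is \<open>q\<close>.\<close>
lemma schur_weights:
  fixes S R :: "'a::field set" and \<alpha> :: 'a
  defines "N \<equiv> \<lambda>r. \<Sum>s\<in>S. 1 / (r - s)^2"
  assumes S: "finite S" and R: "finite R" and al: "\<alpha> \<noteq> 0" and s: "s \<in> S"
    and card: "card S = card R"
    and q: "node_poly R = node_poly S - smult \<alpha> (pderiv (node_poly S))"
  shows "(\<Sum>r\<in>R. 1 / ((r - s)^2 * N r)) = 1"
    and "(\<Sum>r\<in>R. r / ((r - s)^2 * N r)) = s + \<alpha>"
proof -
  let ?p = "node_poly S" and ?q = "node_poly R" and ?ps = "node_poly (S - {s})"
  let ?w = "\<lambda>r. poly ?ps r / poly (pderiv ?q) r"
  have root: "poly ?q r = 0" if "r \<in> R" for r using that R by (simp add: poly_node_poly_eq_0_iff)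
  note facts = node_poly_sub_pderiv_root[OF S al q]
  have notin: "r \<notin> S" if "r \<in> R" for r using facts(1)[OF root[OF that]] .
  \<comment> \<open>The value p(r) cancels between \<open>?ps\<close> at r, which is p(r)/(r - s),
    and the derivative of q at r.\<close>
  have w: "?w r = 1 / (\<alpha> * (r - s) * N r)" if r: "r \<in> R" for r
  proof -
    have ne: "r \<noteq> s" "poly ?p r \<noteq> 0"
      using notin[OF r] S s by (auto simp: poly_node_poly_eq_0_iff)
    then show ?thesis
      by (simp add: facts(3)[OF root[OF r]] poly_node_poly_Diff[OF S s] N_def)
  qed
  have "card S > 0" using S s by (auto simp: card_gt_0_iff)
  then have "degree ?ps < card R" using S s card by simp
  then have lag: "?ps = (\<Sum>r\<in>R. smult (?w r) (node_poly (R - {r})))"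
    by (rule lagrange_interpolation_node_poly[OF R])
  \<comment> \<open>Leading coefficients in the interpolation formula: all basis polynomials are
    monic of the same degree, so the weights sum to 1.\<close>
  have "coeff ?ps (card S - 1) = 1" using lead_coeff_node_poly[of "S - {s}"] S s by simp
  then have "1 = (\<Sum>r\<in>R. ?w r * coeff (node_poly (R - {r})) (card S - 1))"
    by (subst (asm) lag) (simp add: coeff_sum)
  also have "\<dots> = (\<Sum>r\<in>R. ?w r)"
  proof (intro sum.cong refl)
    fix r assume "r \<in> R"
    then show "?w r * coeff (node_poly (R - {r})) (card S - 1) = ?w r"
      using lead_coeff_node_poly[of "R - {r}"] R card by simp
  qed
  finally have a: "(\<Sum>r\<in>R. ?w r) = 1" by simp
  have ps: "poly ?ps s \<noteq> 0" using S by (simp add: poly_node_poly_eq_0_iff)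
  \<comment> \<open>Evaluating the interpolation formula at s itself yields the row sum: p(s) = 0
    leaves only the derivative term of q(s), and the basis polynomials supply the second factor 1/(r
    - s).\<close>
  have qs: "poly ?q s = - \<alpha> * poly ?ps s"
    using S s by (simp add: q poly_node_poly_eq_0_iff poly_pderiv_node_poly)
  have "poly ?ps s = (\<Sum>r\<in>R. ?w r * poly (node_poly (R - {r})) s)"
    by (subst lag) (simp add: poly_sum)
  also have "\<dots> = (\<Sum>r\<in>R. poly ?ps s * (1 / ((r - s)^2 * N r)))"
  proof (intro sum.cong refl)
    fix r assume r: "r \<in> R"
    then have ne: "s \<noteq> r" "r - s \<noteq> 0" "s - r \<noteq> 0" using notin[OF r] s by auto
    have "?w r * poly (node_poly (R - {r})) s = 1 / (\<alpha> * (r - s) * N r) * (- \<alpha> * poly ?ps s / (s - r))"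
      using r R by (simp add: w poly_node_poly_Diff[OF R r ne(1)] qs)
    also have "- \<alpha> * poly ?ps s / (s - r) = \<alpha> * poly ?ps s / (r - s)"
      by (metis minus_diff_eq minus_divide_divide minus_mult_left minus_minus)
    also have "1 / (\<alpha> * (r - s) * N r) * (\<alpha> * poly ?ps s / (r - s))
      = poly ?ps s * (1 / ((r - s)^2 * N r))"
      using al by (simp add: power2_eq_square)
    finally show "?w r * poly (node_poly (R - {r})) s = poly ?ps s * (1 / ((r - s)^2 * N r))" .
  qed
  also have "\<dots> = poly ?ps s * (\<Sum>r\<in>R. 1 / ((r - s)^2 * N r))" by (simp only: sum_distrib_left)
  finally show b: "(\<Sum>r\<in>R. 1 / ((r - s)^2 * N r)) = 1" using ps by simp
  \<comment> \<open>Writing r = s + (r - s) cancels one factor of the square and brings back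
    \<alpha> times the weights, whose sum is 1.\<close>
  have "(\<Sum>r\<in>R. r / ((r - s)^2 * N r)) = (\<Sum>r\<in>R. \<alpha> * ?w r + s * (1 / ((r - s)^2 * N r)))"
  proof (intro sum.cong refl)
    fix r assume r: "r \<in> R"
    then have ne: "r - s \<noteq> 0" using notin[OF r] s by auto
    have "\<alpha> * ?w r = (r - s) / ((r - s)^2 * N r)"
      using al ne by (simp add: w[OF r] power2_eq_square)
    then show "r / ((r - s)^2 * N r) = \<alpha> * ?w r + s * (1 / ((r - s)^2 * N r))"
      by (simp add: diff_divide_distrib)
  qed
  also have "\<dots> = \<alpha> * (\<Sum>r\<in>R. ?w r) + s * (\<Sum>r\<in>R. 1 / ((r - s)^2 * N r))"
    by (simp only: sum.distrib sum_distrib_left)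
  finally show "(\<Sum>r\<in>R. r / ((r - s)^2 * N r)) = s + \<alpha>" by (simp only: a b) simp
qed

section \<open>Real-rooted monic polynomials as multisets of real zeros\<close>

definition root_poly :: "real multiset \<Rightarrow> complex poly" where
  "root_poly M = (\<Prod>x\<in>#M. [:- of_real x, 1:])"

lemma root_poly_empty [simp]: "root_poly {#} = 1"
  by (simp add: root_poly_def)

lemma root_poly_add_mset [simp]:
  "root_poly (add_mset x M) = [:- of_real x, 1:] * root_poly M"
  by (simp add: root_poly_def)

lemma lead_coeff_root_poly: "lead_coeff (root_poly M) = 1"
  by (induction M) (simp_all add: lead_coeff_mult del: mult_pCons_left)

lemma root_poly_nonzero [simp]: "root_poly M \<noteq> 0"
  using lead_coeff_root_poly[of M] by auto

lemma degree_root_poly [simp]: "degree (root_poly M) = size M"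
  by (induction M) (simp_all add: degree_mult_eq del: mult_pCons_left)

lemma proots_root_poly [simp]: "proots (root_poly M) = image_mset of_real M"
  by (induction M) (simp_all add: proots_mult del: mult_pCons_left)

lemma poly_root_poly_mset:
  "poly (root_poly (mset xs)) z = (\<Prod>i<length xs. z - of_real (xs ! i))"
proof -
  have "poly (root_poly (mset xs)) z = (\<Prod>x\<leftarrow>xs. z - of_real x)"
    by (induction xs) (simp_all add: algebra_simps)
  then show ?thesis by (simp add: prod.list_conv_set_nth atLeast0LessThan)
qed

lemma root_poly_in_hyperbolic: "root_poly M \<in> hyperbolic (size M)"
proof -
  have "z \<in> \<real>" if "poly (root_poly M) z = 0" for z
  proof -
    have "z \<in> set_mset (proots (root_poly M))"
      using that by (subst set_count_proots) auto
    then show ?thesis by auto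
  qed
  then show ?thesis by (auto simp: hyperbolic_def lead_coeff_root_poly[simplified])
qed

lemma hyperbolic_imp_root_poly:
  assumes "P \<in> hyperbolic n"
  obtains M where "size M = n" "P = root_poly M"
proof
  have P: "lead_coeff P = 1" "degree P = n" "P \<noteq> 0" using assms by (auto simp: hyperbolic_def)
  show "size (image_mset Re (proots P)) = n" by (simp add: size_proots_complex P)
  have real: "of_real (Re z) = z" if "z \<in># proots P" for z
    using that P assms by (auto simp: hyperbolic_def of_real_Re)
  have "P = (\<Prod>x\<in>#proots P. [:- x, 1:])"
    using complex_poly_decompose_multiset[of P] P by simp
  also have "\<dots> = root_poly (image_mset Re (proots P))"
    using real unfolding root_poly_def image_mset.compositionality comp_def
    by (intro arg_cong[where f = prod_mset] image_mset_cong) simp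
  finally show "P = root_poly (image_mset Re (proots P))" .
qed

lemma poly_spectral_le_root_poly:
  "poly_spectral_le (size X) (root_poly X) (root_poly Y) \<longleftrightarrow> spectral_le X Y"
  using root_poly_in_hyperbolic[of X] root_poly_in_hyperbolic[of Y]
  by (auto simp: poly_spectral_le_def image_mset.compositionality comp_def spectral_le_def)

lemma spectral_le_trans: "spectral_le X Y \<Longrightarrow> spectral_le Y Z \<Longrightarrow> spectral_le X Z"
  unfolding spectral_le_def by (metis order_trans)

text \<open>Lets the shifts caused by successive factors 1 - \<beta>D accumulate.\<close>

lemma spectral_le_translate:
  assumes "spectral_le X Y"
  shows "spectral_le (image_mset (\<lambda>x. x + c) X) (image_mset (\<lambda>x. x + c) Y)"
  unfolding spectral_le_def
proof (intro conjI allI impI)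
  show "size (image_mset (\<lambda>x. x + c) X) = size (image_mset (\<lambda>x. x + c) Y)"
    using assms by (simp add: spectral_le_def)
  fix f :: "real \<Rightarrow> real" assume f: "convex_on UNIV f"
  have "convex_on UNIV (\<lambda>x. f (x + c))"
  proof (rule convex_onI)
    fix t x y :: real assume "0 < t" "t < 1"
    moreover have "(1 - t) *\<^sub>R x + t *\<^sub>R y + c = (1 - t) *\<^sub>R (x + c) + t *\<^sub>R (y + c)"
      by (simp add: algebra_simps)
    ultimately show "f ((1 - t) *\<^sub>R x + t *\<^sub>R y + c) \<le> (1 - t) * f (x + c) + t * f (y + c)"
      using convex_onD[OF f, of t "x + c" "y + c"] by simp
  qed simp
  then show "(\<Sum>x\<in>#image_mset (\<lambda>x. x + c) X. f x) \<le> (\<Sum>y\<in>#image_mset (\<lambda>x. x + c) Y. f y)"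
    using assms by (simp add: spectral_le_def image_mset.compositionality comp_def)
qed

section \<open>Compactness of the zeros\<close>

lemma bounded_imp_simultaneously_convergent_subsequence:
  fixes f :: "nat \<Rightarrow> nat \<Rightarrow> 'a::heine_borel"
  assumes "\<And>i. i < n \<Longrightarrow> bounded (range (\<lambda>k. f k i))"
  shows "\<exists>r l. strict_mono (r :: nat \<Rightarrow> nat) \<and> (\<forall>i<n. (\<lambda>k. f (r k) i) \<longlonglongrightarrow> l i)"
  using assms
proof (induction n)
  case 0
  show ?case using strict_mono_id by auto
next
  case (Suc n)
  then obtain r l where r: "strict_mono (r :: nat \<Rightarrow> nat)" "\<And>i. i < n \<Longrightarrow> (\<lambda>k. f (r k) i) \<longlonglongrightarrow> l i"
    by (metis less_SucI)
  have "bounded (range (\<lambda>k. f (r k) n))"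
    by (rule bounded_subset[OF Suc.prems[of n]]) auto
  then obtain m s where s: "strict_mono (s :: nat \<Rightarrow> nat)" "((\<lambda>k. f (r k) n) \<circ> s) \<longlonglongrightarrow> m"
    using bounded_imp_convergent_subsequence by blast
  have "(\<lambda>k. f ((r \<circ> s) k) i) \<longlonglongrightarrow> (l(n := m)) i" if "i < Suc n" for i
    using that s(2) LIMSEQ_subseq_LIMSEQ[OF r(2) s(1), of i] by (cases "i = n") (auto simp: comp_def)
  moreover have "strict_mono (r \<circ> s)" using r(1) s(1) by (rule strict_mono_o)
  ultimately show ?case by blast
qed

text \<open>Each root \<open>x\<close> is bounded by the value of the polynomial at \<open>\<i>\<close>, as
  \<open>\<bar>\<i> - x\<bar> \<ge> max 1 \<bar>x\<bar>\<close>; so pointwise convergence confines the roots to a compact set.\<close>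
lemma root_poly_limit:
  assumes size: "\<And>k. size (Y k) = n"
    and lim: "\<And>z. (\<lambda>k. poly (root_poly (Y k)) z) \<longlonglongrightarrow> poly Q z"
  obtains Z r where "size Z = n" "Q = root_poly Z" "strict_mono (r :: nat \<Rightarrow> nat)"
    "\<And>f :: real \<Rightarrow> real. continuous_on UNIV f \<Longrightarrow>
      (\<lambda>k. \<Sum>y\<in>#Y (r k). f y) \<longlonglongrightarrow> (\<Sum>y\<in>#Z. f y)"
proof -
  \<comment> \<open>Any enumeration of the zeros will do: no continuous labelling is required, since
    a subsequence makes each position converge.\<close>
  have "\<forall>k. \<exists>xs. mset xs = Y k" using ex_mset by blast
  then obtain ys where ys: "\<And>k. mset (ys k) = Y k" by metis
  have len: "length (ys k) = n" for k using ys[of k] size[of k] by (metis size_mset)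
  have val: "poly (root_poly (Y k)) z = (\<Prod>i<n. z - of_real (ys k ! i))" for k z
    using poly_root_poly_mset[of "ys k" z] by (simp add: ys len)
  have "bounded (range (\<lambda>k. ys k ! i))" if i: "i < n" for i
  proof -
    obtain B where B: "\<And>k. norm (poly (root_poly (Y k)) \<i>) \<le> B"
      using convergent_imp_Bseq[OF convergentI[OF lim[of \<i>]]] by (auto simp: Bseq_def)
    have "norm (ys k ! i) \<le> B" for k
    proof -
      have 1: "1 \<le> norm (\<i> - of_real x)" "\<bar>x\<bar> \<le> norm (\<i> - of_real x)" for x :: real
        using abs_Im_le_cmod[of "\<i> - of_real x"] abs_Re_le_cmod[of "\<i> - of_real x"] by simp_all
      have "norm (ys k ! i) \<le> norm (\<i> - of_real (ys k ! i)) * 1" using 1(2) by simp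
      also have "\<dots> \<le> norm (\<i> - of_real (ys k ! i)) * (\<Prod>j\<in>{..<n} - {i}. norm (\<i> - of_real (ys k ! j)))"
        by (intro mult_left_mono prod_ge_1 1(1)) auto
      also have "\<dots> = (\<Prod>j<n. norm (\<i> - of_real (ys k ! j)))"
        using i by (subst prod.remove[of _ i]) auto
      also have "\<dots> = norm (poly (root_poly (Y k)) \<i>)" by (simp add: val prod_norm)
      finally show ?thesis using B[of k] by simp
    qed
    then show ?thesis by (auto intro!: boundedI)
  qed
  then obtain r l where r: "strict_mono (r :: nat \<Rightarrow> nat)" "\<And>i. i < n \<Longrightarrow> (\<lambda>k. ys (r k) ! i) \<longlonglongrightarrow> l i"
    using bounded_imp_simultaneously_convergent_subsequence[of n "\<lambda>k i. ys k ! i"] by blast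
  define Z where "Z = mset (map l [0..<n])"
  have "poly Q z = poly (root_poly Z) z" for z
  proof (rule LIMSEQ_unique)
    show "(\<lambda>k. poly (root_poly (Y (r k))) z) \<longlonglongrightarrow> poly Q z"
      using LIMSEQ_subseq_LIMSEQ[OF lim r(1)] by (simp add: comp_def)
    have "(\<lambda>k. \<Prod>i<n. z - of_real (ys (r k) ! i)) \<longlonglongrightarrow> (\<Prod>i<n. z - of_real (l i))"
      using r(2) by (intro tendsto_intros) auto
    then show "(\<lambda>k. poly (root_poly (Y (r k))) z) \<longlonglongrightarrow> poly (root_poly Z) z"
      unfolding Z_def poly_root_poly_mset val by simp
  qed
  then have Q: "Q = root_poly Z" by (metis poly_eq_poly_eq_iff ext)
  have sums: "(\<lambda>k. \<Sum>y\<in>#Y (r k). f y) \<longlonglongrightarrow> (\<Sum>y\<in>#Z. f y)"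
    if f: "continuous_on UNIV f" for f :: "real \<Rightarrow> real"
  proof -
    have "(\<Sum>y\<in>#Y k. f y) = (\<Sum>i<n. f (ys k ! i))" for k
      unfolding ys[symmetric] mset_map[symmetric] sum_mset_sum_list
      by (simp add: sum.list_conv_set_nth len atLeast0LessThan)
    moreover have "(\<Sum>y\<in>#Z. f y) = (\<Sum>i<n. f (l i))"
      unfolding Z_def mset_map[symmetric] sum_mset_sum_list
      by (simp add: interv_sum_list_conv_sum_set_nat atLeast0LessThan)
    moreover have "(\<lambda>k. \<Sum>i<n. f (ys (r k) ! i)) \<longlonglongrightarrow> (\<Sum>i<n. f (l i))"
      using f r(2) by (intro tendsto_sum continuous_on_tendsto_compose[OF f]) auto
    ultimately show ?thesis by simp
  qed
  show ?thesis by (rule that[OF _ Q r(1) sums]) (simp add: Z_def)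
qed

section \<open>The operator 1 - \<alpha>D\<close>

lemma root_poly_mset_set:
  "root_poly (mset_set S) = node_poly (of_real ` S)"
  by (simp add: root_poly_def node_poly_def prod_unfold_prod_mset[symmetric] prod.reindex inj_on_def)

text \<open>Once q is known to have simple real zeros, the weights of \<open>schur_weights\<close>
  form a square matrix. Jensen's inequality in each row, summed over S, then gives the claim by the
  column sums.\<close>

lemma spectral_le_sub_pderiv_distinct:
  fixes S :: "real set"
  assumes S: "finite S" and al: "\<alpha> \<noteq> 0"
  shows "\<exists>Y. size Y = card S \<and>
    root_poly (mset_set S) - smult (of_real \<alpha>) (pderiv (root_poly (mset_set S))) = root_poly Y \<and>
    spectral_le (image_mset (\<lambda>x. x + \<alpha>) (mset_set S)) Y"
proof -
  define S' where "S' = complex_of_real ` S"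
  let ?p = "node_poly S'"
  define q where "q = ?p - smult (of_real \<alpha>) (pderiv ?p)"
  have S': "finite S'" "card S' = card S"
    using S by (simp_all add: S'_def card_image inj_on_def)
  have al': "complex_of_real \<alpha> \<noteq> 0" using al by simp
  note facts = node_poly_sub_pderiv_root[OF S'(1) al' q_def]
  have sumS': "(\<Sum>s\<in>S'. f s) = (\<Sum>s\<in>S. f (of_real s))" for f :: "complex \<Rightarrow> complex"
    by (simp add: S'_def sum.reindex inj_on_def)
  \<comment> \<open>The imaginary part of the sum of the 1/(z - s) is -Im z times a sum of positive
    terms 1/|z - s|^2, whereas the secular equation makes that sum the real number
    1/\<alpha>.\<close>
  have real: "of_real (Re z) = z" if z: "poly q z = 0" for z
  proof (rule ccontr)
    assume ne: "of_real (Re z) \<noteq> z"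
    then have Im: "Im z \<noteq> 0" by (auto simp: complex_eq_iff)
    have one: "of_real \<alpha> * (\<Sum>s\<in>S. 1 / (z - of_real s)) = 1"
      using facts(2)[OF z] by (simp add: sumS')
    then have "S \<noteq> {}" by auto
    have "(\<Sum>s\<in>S. 1 / (z - of_real s)) = of_real (1 / \<alpha>)"
      using one al by (simp add: field_simps)
    then have "Im (\<Sum>s\<in>S. 1 / (z - of_real s)) = 0" by simp
    then have "Im z * (\<Sum>s\<in>S. 1 / ((Re z - s)^2 + (Im z)^2)) = 0"
      by (simp add: Im_divide sum_distrib_left sum_negf)
    moreover have "(\<Sum>s\<in>S. 1 / ((Re z - s)^2 + (Im z)^2)) > 0"
      using S \<open>S \<noteq> {}\<close> Im by (intro sum_pos) (auto simp: add_nonneg_pos)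
    ultimately show False using Im by simp
  qed
  have N: "(\<Sum>s\<in>S. 1 / (r - s)^2) > 0" if r: "poly q (of_real r) = 0" for r
  proof -
    have "r \<notin> S" "S \<noteq> {}" using facts(1,2)[OF r] by (auto simp: S'_def)
    then show ?thesis using S by (intro sum_pos) auto
  qed
  \<comment> \<open>At a zero of q, all three factors of q' are nonzero: \<alpha>, the value of
    \<open>?p\<close>, and a sum of inverse squares that is positive because the zero is
    real.\<close>
  have "rsquarefree q"
    unfolding rsquarefree_roots
  proof (intro allI notI, elim conjE)
    fix z assume z: "poly q z = 0" "poly (pderiv q) z = 0"
    have "(\<Sum>s\<in>S'. 1 / (z - s)^2) = of_real (\<Sum>s\<in>S. 1 / (Re z - s)^2)"
      by (subst real[OF z(1), symmetric]) (simp add: sumS')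
    moreover have "(\<Sum>s\<in>S. 1 / (Re z - s)^2) > 0"
      using N[of "Re z"] z(1) real[OF z(1)] by simp
    moreover have "poly ?p z \<noteq> 0"
      using facts(1)[OF z(1)] S' by (simp add: poly_node_poly_eq_0_iff)
    ultimately have "poly (pderiv q) z \<noteq> 0"
      unfolding facts(3)[OF z(1)] using al
      by (metis less_irrefl mult_eq_0_iff of_real_eq_0_iff)
    then show False using z(2) by simp
  qed
  define R where "R = {r. poly q (of_real r) = 0}"
  define R' where "R' = complex_of_real ` R"
  have R'_eq: "R' = {z. poly q z = 0}"
  proof (intro equalityI subsetI)
    fix z assume "z \<in> {z. poly q z = 0}"
    then have "z = of_real (Re z)" "Re z \<in> R" using real[of z] by (simp_all add: R_def)
    then show "z \<in> R'" unfolding R'_def by (rule image_eqI)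
  qed (auto simp: R'_def R_def)
  have q_top: "degree q = card S \<and> lead_coeff q = 1"
  proof (cases "card S = 0")
    case True
    then have "S' = {}" using S' by auto
    then show ?thesis using S by (simp add: q_def node_poly_def True)
  next
    case False
    then have "degree (- smult (of_real \<alpha>) (pderiv ?p)) < degree ?p"
      using S' al by (simp add: degree_pderiv)
    moreover have "q = - smult (of_real \<alpha>) (pderiv ?p) + ?p" by (simp add: q_def)
    ultimately have "degree q = degree ?p" "lead_coeff q = lead_coeff ?p"
      using degree_add_eq_right lead_coeff_add_le by metis+
    then show ?thesis using S' lead_coeff_node_poly[of S'] by simp
  qed
  then have "q \<noteq> 0" by auto
  then have "finite R'" by (simp add: R'_eq poly_roots_finite)
  then have R: "finite R" unfolding R'_def by (rule finite_imageD) (simp add: inj_on_def)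
  \<comment> \<open>Monic and squarefree, q is the product over its root set; hence R has as many
    elements as S.\<close>
  have q_node: "node_poly R' = q"
    using complex_poly_decompose_rsquarefree[OF \<open>rsquarefree q\<close>] conjunct2[OF q_top]
    by (simp only: node_poly_def R'_eq smult_1_left)
  then have card': "card S' = card R'" using q_top S' by (metis degree_node_poly)
  have card: "card R = card S" using card' S' by (simp add: R'_def card_image inj_on_def)
  \<comment> \<open>The inner \<open>s\<close> is bound by the sum, so the normalizing factor
    depends on r alone; this makes the column sums 1.\<close>
  define A where "A s r = 1 / ((r - s)^2 * (\<Sum>s\<in>S. 1 / (r - s)^2))" for s r
  have sumR': "(\<Sum>s\<in>R'. f s) = (\<Sum>s\<in>R. f (of_real s))" for f :: "complex \<Rightarrow> complex"
    by (simp add: R'_def sum.reindex inj_on_def)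
  have A_nonneg: "A s r \<ge> 0" for s r by (simp add: A_def sum_nonneg)
  have row: "(\<Sum>r\<in>R. A s r) = 1" "(\<Sum>r\<in>R. A s r * r) = s + \<alpha>" if s: "s \<in> S" for s
  proof -
    have s': "of_real s \<in> S'" using s by (simp add: S'_def)
    note w = schur_weights[OF S'(1) \<open>finite R'\<close> al' s' card' q_node[unfolded q_def]]
    have "complex_of_real (\<Sum>r\<in>R. A s r) = of_real 1"
      using w(1) by (simp add: sumS' sumR' A_def)
    then show "(\<Sum>r\<in>R. A s r) = 1" by (simp only: of_real_eq_iff)
    have "complex_of_real (\<Sum>r\<in>R. A s r * r) = of_real (s + \<alpha>)"
      using w(2) by (simp add: sumS' sumR' A_def)
    then show "(\<Sum>r\<in>R. A s r * r) = s + \<alpha>" by (simp only: of_real_eq_iff)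
  qed
  have col: "(\<Sum>s\<in>S. A s r) = 1" if r: "r \<in> R" for r
  proof -
    define N where "N = (\<Sum>s\<in>S. 1 / (r - s)^2)"
    have "(\<Sum>s\<in>S. A s r) = (\<Sum>s\<in>S. 1 / (r - s)^2 / N)"
      by (simp add: A_def N_def)
    also have "\<dots> = (\<Sum>s\<in>S. 1 / (r - s)^2) / (\<Sum>s\<in>S. 1 / (r - s)^2)"
      by (simp only: sum_divide_distrib N_def)
    finally show ?thesis using N[of r] r unfolding R_def by simp
  qed
  have "spectral_le (image_mset (\<lambda>x. x + \<alpha>) (mset_set S)) (mset_set R)"
    unfolding spectral_le_def
  proof (intro conjI allI impI)
    show "size (image_mset (\<lambda>x. x + \<alpha>) (mset_set S)) = size (mset_set R)" using card by simp
    fix f :: "real \<Rightarrow> real" assume f: "convex_on UNIV f"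
    have "(\<Sum>s\<in>S. f (s + \<alpha>)) \<le> (\<Sum>s\<in>S. \<Sum>r\<in>R. A s r * f r)"
    proof (rule sum_mono)
      fix s assume s: "s \<in> S"
      then have "R \<noteq> {}" using row(1)[OF s] by auto
      have "f (\<Sum>r\<in>R. A s r *\<^sub>R r) \<le> (\<Sum>r\<in>R. A s r * f r)"
        by (rule convex_on_sum[OF R \<open>R \<noteq> {}\<close> f]) (use row[OF s] A_nonneg in auto)
      then show "f (s + \<alpha>) \<le> (\<Sum>r\<in>R. A s r * f r)" by (simp add: row(2)[OF s])
    qed
    also have "\<dots> = (\<Sum>r\<in>R. (\<Sum>s\<in>S. A s r) * f r)"
      by (subst sum.swap) (simp add: sum_distrib_right)
    also have "\<dots> = (\<Sum>r\<in>R. f r)" by (simp add: col)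
    finally show "(\<Sum>x\<in>#image_mset (\<lambda>x. x + \<alpha>) (mset_set S). f x) \<le> (\<Sum>y\<in>#mset_set R. f y)"
      by (simp add: image_mset.compositionality comp_def sum_unfold_sum_mset)
  qed
  then show ?thesis
    using card q_node by (intro exI[of _ "mset_set R"]) (auto simp: root_poly_mset_set q_def S'_def R'_def)
qed

text \<open>Multiple roots are separated by perturbing the \<open>i\<close>-th smallest root by \<open>i / k\<close>.\<close>
lemma spectral_le_sub_pderiv:
  "\<exists>Y. size Y = size X \<and>
    root_poly X - smult (of_real \<alpha>) (pderiv (root_poly X)) = root_poly Y \<and>
    spectral_le (image_mset (\<lambda>x. x + \<alpha>) X) Y"
proof (cases "\<alpha> = 0")
  case True
  then show ?thesis by (intro exI[of _ X]) (simp add: spectral_le_def)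
next
  case False
  define xs where "xs = sorted_list_of_multiset X"
  define n where "n = length xs"
  have X: "X = mset xs" by (simp add: xs_def)
  \<comment> \<open>The shifts increase with i, so the sorted list becomes strictly increasing;
    \<open>Suc k\<close> keeps the denominator positive at k = 0.\<close>
  define x where "x k i = xs ! i + real i / real (Suc k)" for k i
  have mono: "x k i < x k j" if "i < j" "j < n" for k i j
  proof -
    have "xs ! i \<le> xs ! j"
      using that by (intro sorted_nth_mono) (auto simp: xs_def n_def sorted_sorted_list_of_multiset)
    moreover have "real i / real (Suc k) < real j / real (Suc k)"
      using that by (intro divide_strict_right_mono) auto
    ultimately show ?thesis by (simp add: x_def)
  qed
  have inj: "inj_on (x k) {..<n}" for k
    by (rule linorder_inj_onI') (use mono[of _ _ k] in force)
  define S where "S k = x k ` {..<n}" for k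
  have fin: "finite (S k)" for k by (simp add: S_def)
  have "\<forall>k. \<exists>Y. size Y = card (S k) \<and>
    root_poly (mset_set (S k)) - smult (of_real \<alpha>) (pderiv (root_poly (mset_set (S k)))) = root_poly Y \<and>
    spectral_le (image_mset (\<lambda>x. x + \<alpha>) (mset_set (S k))) Y"
    using spectral_le_sub_pderiv_distinct[OF fin False] by blast
  then obtain Y where Y: "\<And>k. size (Y k) = card (S k)"
    "\<And>k. root_poly (mset_set (S k)) - smult (of_real \<alpha>) (pderiv (root_poly (mset_set (S k)))) = root_poly (Y k)"
    "\<And>k. spectral_le (image_mset (\<lambda>x. x + \<alpha>) (mset_set (S k))) (Y k)"
    by metis
  have size: "size (Y k) = n" for k by (simp add: Y(1) S_def card_image inj)
  have root_k: "root_poly (mset_set (S k)) = (\<Prod>i<n. [:- of_real (x k i), 1:])" for k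
    by (simp add: root_poly_def prod_unfold_prod_mset[symmetric] S_def prod.reindex inj)
  have root_X: "root_poly X = (\<Prod>i<n. [:- of_real (xs ! i), 1:])"
  proof -
    have "root_poly X = (\<Prod>x\<leftarrow>xs. [:- of_real x, 1:])"
      unfolding X root_poly_def mset_map[symmetric] prod_mset_prod_list ..
    then show ?thesis by (simp add: prod.list_conv_set_nth atLeast0LessThan n_def)
  qed
  have xlim: "(\<lambda>k. x k i) \<longlonglongrightarrow> xs ! i" for i
  proof -
    have "(\<lambda>k. xs ! i + real i * (1 / real (Suc k))) \<longlonglongrightarrow> xs ! i + real i * 0"
      by (intro tendsto_intros LIMSEQ_Suc[OF lim_1_over_n])
    then show ?thesis by (simp add: x_def)
  qed
  have "(\<lambda>k. poly (root_poly (Y k)) z) \<longlonglongrightarrow>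
    poly (root_poly X - smult (of_real \<alpha>) (pderiv (root_poly X))) z" for z
    unfolding Y(2)[symmetric] root_k root_X pderiv_prod
    by (simp add: poly_prod poly_sum pderiv_pCons, intro tendsto_intros xlim)
  from root_poly_limit[of Y n, OF size this] obtain Z r where Z: "size Z = n" "root_poly X - smult (of_real \<alpha>) (pderiv (root_poly X)) = root_poly Z"
    and r: "strict_mono (r :: nat \<Rightarrow> nat)"
    and sums: "\<And>f :: real \<Rightarrow> real. continuous_on UNIV f \<Longrightarrow>
      (\<lambda>k. \<Sum>y\<in>#Y (r k). f y) \<longlonglongrightarrow> (\<Sum>y\<in>#Z. f y)"
    by metis
  have "spectral_le (image_mset (\<lambda>x. x + \<alpha>) X) Z"
    unfolding spectral_le_def
  proof (intro conjI allI impI)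
    show "size (image_mset (\<lambda>x. x + \<alpha>) X) = size Z" by (simp add: Z X n_def)
    fix f :: "real \<Rightarrow> real" assume f: "convex_on UNIV f"
    then have cont: "continuous_on UNIV f" by (intro convex_on_continuous) auto
    have "(\<lambda>k. \<Sum>i<n. f (x (r k) i + \<alpha>)) \<longlonglongrightarrow> (\<Sum>i<n. f (xs ! i + \<alpha>))"
      using LIMSEQ_subseq_LIMSEQ[OF xlim r]
      by (intro tendsto_sum continuous_on_tendsto_compose[OF cont] tendsto_intros) (auto simp: comp_def)
    moreover have "(\<Sum>i<n. f (x (r k) i + \<alpha>)) \<le> (\<Sum>y\<in>#Y (r k). f y)" for k
    proof -
      have "(\<Sum>x\<in>#image_mset (\<lambda>x. x + \<alpha>) (mset_set (S (r k))). f x) = (\<Sum>i<n. f (x (r k) i + \<alpha>))"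
        by (simp add: image_mset.compositionality comp_def sum_unfold_sum_mset[symmetric]
            S_def sum.reindex inj)
      then show ?thesis using Y(3)[of "r k"] f by (auto simp: spectral_le_def)
    qed
    ultimately have "(\<Sum>i<n. f (xs ! i + \<alpha>)) \<le> (\<Sum>y\<in>#Z. f y)"
      using sums[OF cont] by (intro LIMSEQ_le) auto
    moreover have "(\<Sum>x\<in>#image_mset (\<lambda>x. x + \<alpha>) X. f x) = (\<Sum>i<n. f (xs ! i + \<alpha>))"
      unfolding X mset_map[symmetric] sum_mset_sum_list
      by (simp add: sum.list_conv_set_nth n_def atLeast0LessThan)
    ultimately show "(\<Sum>x\<in>#image_mset (\<lambda>x. x + \<alpha>) X. f x) \<le> (\<Sum>y\<in>#Z. f y)" by simp
  qed
  then show ?thesis using Z by (intro exI[of _ Z]) (simp add: X n_def)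
qed

section \<open>Differential operators with constant coefficients\<close>

text \<open>This is \<phi>(D) for the formal power series \<phi> with coefficients \<open>a\<close>.
  Derivatives beyond the degree vanish, so the cutoff loses nothing and \<open>a\<close> may be
  arbitrary.\<close>

definition diff_op :: "(nat \<Rightarrow> 'a::field_char_0) \<Rightarrow> 'a poly \<Rightarrow> 'a poly" where
  "diff_op a P = (\<Sum>k\<le>degree P. smult (a k) ((pderiv ^^ k) P))"

lemma smult_sum_right: "smult c (\<Sum>x\<in>A. g x) = (\<Sum>x\<in>A. smult c (g x))"
  by (induction A rule: infinite_finite_induct) (simp_all add: smult_add_right)

lemma higher_pderiv_eq_0: "degree P < k \<Longrightarrow> (pderiv ^^ k) P = 0"
  by (rule poly_eqI) (simp add: coeff_higher_pderiv coeff_eq_0)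

lemma diff_op_eq_sum:
  assumes "degree P \<le> N"
  shows "diff_op a P = (\<Sum>k\<le>N. smult (a k) ((pderiv ^^ k) P))"
  unfolding diff_op_def using assms
  by (intro sum.mono_neutral_left) (auto simp: higher_pderiv_eq_0)

lemma diff_op_add: "diff_op a (P + Q) = diff_op a P + diff_op a Q"
proof -
  let ?N = "max (degree P) (degree Q)"
  have "degree (P + Q) \<le> ?N" by (rule degree_add_le_max)
  then show ?thesis
    by (simp add: diff_op_eq_sum[of _ ?N] higher_pderiv_add smult_add_right sum.distrib)
qed

lemma diff_op_smult: "diff_op a (smult c P) = smult c (diff_op a P)"
  by (simp add: diff_op_eq_sum[OF degree_smult_le] diff_op_def[of a P] higher_pderiv_smult
      smult_sum_right mult.commute)

lemma linear_diff_op: "Vector_Spaces.linear smult smult (diff_op a)"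
  by unfold_locales (simp_all add: diff_op_add diff_op_smult smult_add_right smult_add_left)

lemma higher_pderiv_pcompose_translate:
  "(pderiv ^^ k) (P \<circ>\<^sub>p [:c, 1:]) = (pderiv ^^ k) P \<circ>\<^sub>p [:c, 1:]"
  by (induction k) (simp_all add: pderiv_pcompose pderiv_pCons)

lemma diff_op_pcompose_translate: "diff_op a (P \<circ>\<^sub>p [:c, 1:]) = diff_op a P \<circ>\<^sub>p [:c, 1:]"
  by (simp add: diff_op_def higher_pderiv_pcompose_translate pcompose_sum pcompose_smult degree_pcompose)

text \<open>Recovers \<open>a\<close> from the images of monomials: j = 0 gives a_m m!, and j = m -
  k gives the coefficients of the approximating products.\<close>

lemma coeff_diff_op_monom:
  "coeff (diff_op a (monom 1 m)) j = (if j \<le> m then a (m - j) * fact m / fact j else 0)"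
proof -
  have "coeff (diff_op a (monom 1 m)) j =
    (\<Sum>k\<le>m. if k = m - j \<and> j \<le> m then a k * pochhammer (of_nat (Suc j)) k else 0)"
    unfolding diff_op_eq_sum[OF degree_monom_le] coeff_sum
    by (intro sum.cong) (auto simp: coeff_higher_pderiv)
  also have "\<dots> = (if j \<le> m then a (m - j) * pochhammer (of_nat (Suc j)) (m - j) else 0)"
    by (auto simp: sum.delta)
  also have "\<dots> = (if j \<le> m then a (m - j) * fact m / fact j else 0)"
  proof -
    have "pochhammer (of_nat (Suc j)) (m - j) * (fact j :: 'a) = fact m" if "j \<le> m"
    proof -
      have "(fact m :: 'a) = pochhammer 1 (j + (m - j))" using that by (simp add: pochhammer_fact)
      also have "\<dots> = fact j * pochhammer (1 + of_nat j) (m - j)"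
        by (simp only: pochhammer_product' pochhammer_fact)
      finally show ?thesis by (simp add: ac_simps)
    qed
    then show ?thesis by (auto simp: field_simps)
  qed
  finally show ?thesis .
qed

lemma diff_op_linear_factor:
  "diff_op (coeff ([:1, - \<beta>:] * p)) P
    = diff_op (coeff p) P - smult \<beta> (pderiv (diff_op (coeff p) P))"
proof -
  let ?d = "degree P"
  let ?D = "\<lambda>k. (pderiv ^^ k) P"
  have c: "coeff ([:1, - \<beta>:] * p) k = coeff p k - (case k of 0 \<Rightarrow> 0 | Suc i \<Rightarrow> \<beta> * coeff p i)" for k
    by (simp add: coeff_pCons split: nat.split)
  \<comment> \<open>The cutoff is one above the degree, so that after the index shift the second sum
    has exactly the terms of the derivative of \<open>diff_op (coeff p) P\<close>.\<close>
  have "diff_op (coeff ([:1, - \<beta>:] * p)) P = (\<Sum>k\<le>Suc ?d. smult (coeff p k) (?D k))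
      - (\<Sum>k\<le>Suc ?d. smult (case k of 0 \<Rightarrow> 0 | Suc i \<Rightarrow> \<beta> * coeff p i) (?D k))"
    unfolding c diff_op_eq_sum[of P "Suc ?d", OF le_SucI[OF order_refl]]
    by (simp only: smult_diff_left sum_subtractf)
  also have "(\<Sum>k\<le>Suc ?d. smult (coeff p k) (?D k)) = diff_op (coeff p) P"
    by (rule diff_op_eq_sum[symmetric]) simp
  also have "(\<Sum>k\<le>Suc ?d. smult (case k of 0 \<Rightarrow> 0 | Suc i \<Rightarrow> \<beta> * coeff p i) (?D k))
    = (\<Sum>k\<le>?d. smult (\<beta> * coeff p k) (?D (Suc k)))"
    by (subst sum.atMost_Suc_shift) simp
  also have "\<dots> = smult \<beta> (pderiv (diff_op (coeff p) P))"
    using higher_pderiv_sum[of 1 "\<lambda>k. smult (coeff p k) (?D k)" "{..?d}"]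
    by (simp add: diff_op_def pderiv_smult smult_sum_right)
  finally show ?thesis .
qed

text \<open>Since x and -x are both convex, the order forces equal sums of entries. Each factor 1 -
  \<beta>D raises every mean by \<beta>, so the accumulated shift has to be carried along.\<close>

lemma spectral_le_diff_op_prod:
  "\<exists>Y. size Y = size X \<and>
    diff_op (coeff (\<Prod>\<beta>\<in>#M. [:1, - of_real \<beta>:])) (root_poly X) = root_poly Y \<and>
    spectral_le (image_mset (\<lambda>x. x + sum_mset M) X) Y"
proof (induction M)
  case empty
  have "diff_op (coeff 1) (root_poly X) = (\<Sum>k\<le>size X. if k = 0 then root_poly X else 0)"
    unfolding diff_op_def degree_root_poly by (intro sum.cong) auto
  then have "diff_op (coeff 1) (root_poly X) = root_poly X" by simp
  then show ?case by (intro exI[of _ X]) (simp add: spectral_le_def del: coeff_1)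
next
  case (add \<beta> M)
  then obtain Y where Y: "size Y = size X"
    "diff_op (coeff (\<Prod>\<beta>\<in>#M. [:1, - of_real \<beta>:])) (root_poly X) = root_poly Y"
    "spectral_le (image_mset (\<lambda>x. x + sum_mset M) X) Y" by blast
  obtain Z where Z: "size Z = size Y"
    "root_poly Y - smult (of_real \<beta>) (pderiv (root_poly Y)) = root_poly Z"
    "spectral_le (image_mset (\<lambda>x. x + \<beta>) Y) Z"
    using spectral_le_sub_pderiv by blast
  have "spectral_le (image_mset (\<lambda>x. x + (\<beta> + sum_mset M)) X) (image_mset (\<lambda>x. x + \<beta>) Y)"
    using spectral_le_translate[OF Y(3), of \<beta>]
    by (simp add: image_mset.compositionality comp_def ac_simps)
  then have "spectral_le (image_mset (\<lambda>x. x + sum_mset (add_mset \<beta> M)) X) Z"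
    using Z(3) spectral_le_trans by simp
  moreover have "diff_op (coeff (\<Prod>\<beta>\<in>#add_mset \<beta> M. [:1, - of_real \<beta>:])) (root_poly X) = root_poly Z"
    by (simp only: image_mset_add_mset prod_mset.add_mset diff_op_linear_factor Y(2) Z(2))
  ultimately show ?case using Y(1) Z(1) by metis
qed

section \<open>Coefficients and symmetric functions of the zeros\<close>

text \<open>Links the zeros of T x^m to symbols with constant term 1. A zero at 0 contributes the
  constant factor 1.\<close>

lemma reflect_root_poly: "reflect_poly (root_poly M) = (\<Prod>x\<in>#M. [:1, - of_real x:])"
proof (induction M)
  case (add x M)
  have "reflect_poly [:- of_real x, 1 :: complex:] = [:1, - of_real x:]"
    by (rule poly_eqI) (auto simp: coeff_reflect_poly coeff_pCons split: nat.splits)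
  then show ?case using add by (simp add: reflect_poly_mult del: mult_pCons_left)
qed simp

lemma coeff_root_poly_sum_mset:
  assumes "size M \<ge> 1"
  shows "coeff (root_poly M) (size M - 1) = - of_real (sum_mset M)"
proof -
  have "coeff (\<Prod>x\<in>#M. [:1, - of_real x :: complex:]) 0 = 1 \<and>
    coeff (\<Prod>x\<in>#M. [:1, - of_real x :: complex:]) 1 = - of_real (sum_mset M)"
    by (induction M) (simp_all add: coeff_pCons)
  then show ?thesis
    using assms by (simp add: reflect_root_poly[symmetric] coeff_reflect_poly split: if_splits)
qed

text \<open>Newton's identity for the second power sum, proved on the reversed polynomial, where the
  coefficients concerned have the fixed indices 1 and 2.\<close>

lemma sum_mset_power2_root_poly:
  assumes "size M \<ge> 2"
  shows "of_real (\<Sum>x\<in>#M. x^2)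
    = coeff (root_poly M) (size M - 1) ^ 2 - 2 * coeff (root_poly M) (size M - 2)"
proof -
  have "coeff (\<Prod>x\<in>#M. [:1, - of_real x :: complex:]) 0 = 1 \<and>
    of_real (\<Sum>x\<in>#M. x^2) = coeff (\<Prod>x\<in>#M. [:1, - of_real x :: complex:]) 1 ^ 2
      - 2 * coeff (\<Prod>x\<in>#M. [:1, - of_real x :: complex:]) 2"
  proof (induction M)
    case (add x M)
    then show ?case
      by (simp add: coeff_pCons numeral_2_eq_2 algebra_simps power2_eq_square)
  qed simp
  then show ?thesis
    using assms by (simp add: reflect_root_poly[symmetric] coeff_reflect_poly split: if_splits)
qed

text \<open>Factor by factor, |x| \<le> 1 + x^2 \<le> exp(x^2); the first inequality is the
  completed square x^2 - |x| + 1 = (|x| - 1/2)^2 + 3/4.\<close>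

lemma norm_poly_root_poly_0_le: "norm (poly (root_poly M) 0) \<le> exp (\<Sum>x\<in>#M. x^2)"
proof (induction M)
  case (add x M)
  have "0 \<le> (\<bar>x\<bar> - 1/2)^2 + 3/4" by simp
  then have "\<bar>x\<bar> \<le> 1 + x^2" by (simp add: power2_diff power2_eq_square algebra_simps)
  also have "\<dots> \<le> exp (x^2)" by (rule exp_ge_add_one_self)
  finally show ?case using add by (simp add: norm_mult exp_add mult_mono)
qed simp

lemma root_poly_pcompose_translate:
  "root_poly M \<circ>\<^sub>p [:of_real c, 1:] = root_poly (image_mset (\<lambda>x. x - c) M)"
  by (induction M) (simp_all add: pcompose_mult pcompose_pCons pcompose_1 one_pCons[symmetric] del: mult_pCons_left)

lemma zeros_mean_root_poly: "zeros_mean (root_poly M) = of_real (sum_mset M) / of_nat (size M)"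
proof -
  have "(\<Sum>x\<in>#M. complex_of_real x) = of_real (sum_mset M)" by (induction M) simp_all
  then show ?thesis by (simp add: zeros_mean_def)
qed

lemma monom_1_eq_root_poly: "monom 1 n = root_poly (replicate_mset n 0)"
  by (induction n) (simp_all add: monom_Suc monom_0 one_pCons)

section \<open>Mean-preserving operators are differential operators\<close>

lemma degree_pcompose_translate_diff_less:
  fixes P :: "'a::field poly"
  assumes "degree P \<ge> 1"
  shows "degree (P \<circ>\<^sub>p [:c, 1:] - P) < degree P"
proof (rule degree_lessI)
  show "\<forall>k\<ge>degree P. coeff (P \<circ>\<^sub>p [:c, 1:] - P) k = 0"
  proof (intro allI impI)
    fix k assume "k \<ge> degree P"
    then show "coeff (P \<circ>\<^sub>p [:c, 1:] - P) k = 0"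
      using lead_coeff_comp[of "[:c, 1:]" P] degree_pcompose[of P "[:c, 1:]"]
      by (cases "k = degree P") (simp_all add: coeff_eq_0)
  qed
qed (use assms in auto)

lemma linear_poly_eqI_degree_less:
  fixes T U :: "'a::field poly \<Rightarrow> 'a poly"
  assumes "Vector_Spaces.linear smult smult T" "Vector_Spaces.linear smult smult U"
    and "\<And>k. k < n \<Longrightarrow> T (monom 1 k) = U (monom 1 k)" and "degree P < n"
  shows "T P = U P"
proof -
  have P: "P = (\<Sum>k\<le>degree P. smult (coeff P k) (monom 1 k))"
    by (subst (1) poly_as_sum_of_monoms[symmetric]) (simp add: smult_monom)
  have "F P = (\<Sum>k\<le>degree P. smult (coeff P k) (F (monom 1 k)))"
    if "Vector_Spaces.linear smult smult F" for F :: "'a poly \<Rightarrow> 'a poly"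
  proof -
    interpret F: Vector_Spaces.linear smult smult F by fact
    show ?thesis by (subst (1) P) (simp add: F.sum F.scale del: smult_monom)
  qed
  from this[OF assms(1)] this[OF assms(2)] show ?thesis using assms(3,4) by simp
qed

text \<open>By induction \<open>T\<close> agrees with \<open>diff_op a\<close> below degree \<open>n\<close>, so the translates of
  \<open>T ((x - c) ^ n)\<close> are \<open>G + e (x + c)\<close> with \<open>G\<close>, \<open>e\<close> independent of \<open>c\<close>. Their two
  subleading coefficients, hence the sum of the squares of their zeros, do not depend on \<open>c\<close>;
  this bounds the value at 0, so \<open>e\<close> is constant.\<close>
lemma mean_preserver_is_diff_op:
  assumes T: "T \<in> mean_preservers"
  obtains a where "T = diff_op a"
proof
  \<comment> \<open>The only possible choice: the constant coefficient of \<phi>(D) x^k is a_k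
    k!.\<close>
  define a where "a k = coeff (T (monom 1 k)) 0 / fact k" for k
  have lin: "Vector_Spaces.linear smult smult T"
    and hyp: "\<And>P n. P \<in> hyperbolic n \<Longrightarrow> T P \<in> hyperbolic n"
    and mean: "\<And>P. degree P \<ge> 1 \<Longrightarrow> zeros_mean (T P) = zeros_mean P"
    using T by (auto simp: mean_preservers_def hyperbolic_preservers_def)
  interpret T: Vector_Spaces.linear smult smult T by (rule lin)
  interpret D: Vector_Spaces.linear smult smult "diff_op a" by (rule linear_diff_op)
  have monom_hyp: "monom 1 n \<in> hyperbolic n" for n
    unfolding monom_1_eq_root_poly using root_poly_in_hyperbolic[of "replicate_mset n 0"] by simp
  have sub: "coeff (T (monom 1 n)) (n - 1) = 0" if n: "n \<ge> 1" for n
  proof -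
    obtain B where B: "size B = n" "T (monom 1 n) = root_poly B"
      using hyp[OF monom_hyp] hyperbolic_imp_root_poly by metis
    have "zeros_mean (T (monom 1 n)) = zeros_mean (monom 1 n)"
      using n by (intro mean) (simp add: degree_monom_eq)
    then have "complex_of_real (sum_mset B) = 0"
      using B n by (simp add: zeros_mean_root_poly monom_1_eq_root_poly)
    then show ?thesis using coeff_root_poly_sum_mset[of B] B n by simp
  qed
  have a0: "a 0 = 1"
    using hyp[OF monom_hyp[of 0]] by (simp add: a_def hyperbolic_0)
  have a1: "a 1 = 0" using sub[of 1] by (simp add: a_def)
  have monoms: "T (monom 1 n) = diff_op a (monom 1 n)" for n
  proof (induction n rule: less_induct)
    case (less n)
    define G where "G = diff_op a (monom 1 n)"
    define e where "e = T (monom 1 n) - G"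
    have below: "T P = diff_op a P" if "degree P < n" for P
      using linear_poly_eqI_degree_less[OF lin linear_diff_op less that] .
    have e0: "coeff e 0 = 0" by (simp add: e_def G_def coeff_diff_op_monom a_def)
    \<comment> \<open>Coefficients n and n - 1 of e vanish: T x^n and G are both monic, and the mean
      condition kills coefficient n - 1 of each, through \<open>sub\<close> and \<open>a1\<close>.
      This will force \<open>degree e + 2 \<le> n\<close>.\<close>
    have e_high: "coeff e k = 0" if k: "k + 1 \<ge> n" "n \<ge> 1" for k
    proof -
      have top: "coeff (T (monom 1 n)) n = 1" "degree (T (monom 1 n)) = n"
        using hyp[OF monom_hyp[of n]] by (auto simp: hyperbolic_def)
      consider "k > n" | "k = n" | "k = n - 1" using k by linarith
      then show ?thesis
      proof cases
        case 3
        then show ?thesis using sub[OF k(2)] a1 k by (simp add: e_def G_def coeff_diff_op_monom)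
      qed (use top in \<open>simp_all add: e_def G_def coeff_diff_op_monom a0 coeff_eq_0\<close>)
    qed
    have "degree e = 0"
    proof (rule ccontr)
      assume "degree e \<noteq> 0"
      then have de: "degree e \<ge> 1" "lead_coeff e \<noteq> 0" by auto
      have n1: "n \<ge> 1"
      proof (rule ccontr)
        assume "\<not> n \<ge> 1"
        then have "n = 0" by simp
        then have "T (monom 1 n) = 1" "G = 1"
          using hyp[OF monom_hyp[of 0]] hyperbolic_0 a0 by (auto simp: G_def diff_op_def)
        then show False using de by (simp add: e_def)
      qed
      then have "\<not> degree e + 1 \<ge> n" using e_high[of "degree e"] de by auto
      then have n2: "degree e + 2 \<le> n" by simp
      \<comment> \<open>\<open>F c\<close> is T((x - c)^n) translated back by c. The induction
        hypothesis covers (x - c)^n - x^n, of degree below n, and \<open>diff_op a\<close> commutes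
        with translations, so only e feels c.\<close>
      define F where "F c = G + e \<circ>\<^sub>p [:of_real c, 1:]" for c
      have "\<exists>M. size M = n \<and> F c = root_poly M" for c
      proof -
        define L where "L = monom 1 n \<circ>\<^sub>p [:- complex_of_real c, 1:]"
        have L_root: "L = root_poly (image_mset (\<lambda>x. x - (- c)) (replicate_mset n 0))"
          unfolding L_def monom_1_eq_root_poly root_poly_pcompose_translate[symmetric] by simp
        then have "L \<in> hyperbolic n"
          using root_poly_in_hyperbolic[of "image_mset (\<lambda>x. x - (- c)) (replicate_mset n 0)"] by simp
        then obtain M where M: "size M = n" "T L = root_poly M"
          using hyp hyperbolic_imp_root_poly by metis
        have "degree (L - monom 1 n) < n"
          using degree_pcompose_translate_diff_less[of "monom (1::complex) n"] n1
          by (simp add: L_def degree_monom_eq)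
        then have "T (L - monom 1 n) = diff_op a (L - monom 1 n)" by (rule below)
        then have "T L = diff_op a L + e"
          using T.diff[of L] D.diff[of L]
          by (simp add: e_def G_def algebra_simps)
        also have "diff_op a L = G \<circ>\<^sub>p [:- of_real c, 1:]"
          by (simp add: L_def G_def diff_op_pcompose_translate)
        finally have "T L \<circ>\<^sub>p [:of_real c, 1:] = F c"
          by (simp add: F_def pcompose_add pcompose_assoc[symmetric] pcompose_pCons pcompose_idR)
        then show ?thesis using M root_poly_pcompose_translate[of M c] by (metis size_image_mset)
      qed
      then obtain M where M: "\<And>c. size (M c) = n" "\<And>c. F c = root_poly (M c)" by metis
      define K where "K = (\<Sum>x\<in>#M 0. x^2)"
      have K: "(\<Sum>x\<in>#M c. x^2) = K" for c
      proof -
        \<comment> \<open>Translation alters e only below its degree, which is at most n - 2;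
          coefficients n - 1 and n - 2 of \<open>F c\<close> are thus constant in c.\<close>
        have "coeff (F c) k = coeff (F 0) k" if "k \<ge> degree e" for k
        proof -
          have "coeff (e \<circ>\<^sub>p [:of_real c, 1:] - e) k = 0"
            using degree_pcompose_translate_diff_less[OF de(1), of "of_real c"] that
            by (intro coeff_eq_0) simp
          then show ?thesis by (simp add: F_def pcompose_idR)
        qed
        then have "complex_of_real (\<Sum>x\<in>#M c. x^2) = of_real K"
          using n2 M unfolding K_def by (subst (1 2) sum_mset_power2_root_poly) auto
        then show ?thesis by (simp only: of_real_eq_iff)
      qed
      have bound: "norm (poly e (of_real c)) \<le> exp K + norm (poly G 0)" for c
      proof -
        have "poly e (of_real c) = poly (F c) 0 - poly G 0" by (simp add: F_def poly_pcompose)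
        then show ?thesis
          using norm_triangle_ineq4[of "poly (F c) 0" "poly G 0"] norm_poly_root_poly_0_le[of "M c"]
          by (simp add: M K)
      qed
      obtain e' where e': "e = pCons (coeff e 0) e'" by (cases e) auto
      then have "e' \<noteq> 0" using de by (metis degree_pCons_0 not_one_le_zero)
      from poly_infinity[OF this, of "exp K + norm (poly G 0) + 1" "coeff e 0"]
      obtain r where r: "\<And>z. r \<le> norm z \<Longrightarrow> exp K + norm (poly G 0) + 1 \<le> norm (poly e z)"
        using e' by metis
      have "r \<le> norm (complex_of_real \<bar>r\<bar>)" by simp
      from r[OF this] bound[of "\<bar>r\<bar>"] show False by linarith
    qed
    then have "e = 0" using e0 by (metis degree_eq_zeroE coeff_pCons_0 pCons_0_0)
    then show ?case by (simp add: e_def G_def)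
  qed
  show "T = diff_op a"
  proof
    fix P show "T P = diff_op a P"
      using linear_poly_eqI_degree_less[OF lin linear_diff_op monoms, of P "Suc (degree P)"] by simp
  qed
qed

section \<open>Approximation of T by products of linear factors in D\<close>

text \<open>For m > k the quotient is the product of the k factors 1 - i/m with i < k, each tending
  to 1.\<close>

lemma fact_div_fact_power_tendsto:
  "(\<lambda>m. fact m / (fact (m - k) * of_nat m ^ k) :: 'a::real_normed_field) \<longlonglongrightarrow> 1"
proof -
  have "(\<lambda>m. \<Prod>i<k. 1 - of_nat i * (1 / of_nat m) :: 'a) \<longlonglongrightarrow> (\<Prod>i<k. 1 - of_nat i * 0)"
    by (intro tendsto_intros lim_1_over_n)
  moreover have "\<forall>\<^sub>F m in sequentially. (\<Prod>i<k. 1 - of_nat i * (1 / of_nat m) :: 'a)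
    = fact m / (fact (m - k) * of_nat m ^ k)"
    using eventually_gt_at_top[of k]
  proof eventually_elim
    case (elim m)
    have "(fact m :: 'a) = fact (m - j) * (\<Prod>i<j. of_nat m - of_nat i)" if "j \<le> k" for j
      using that
    proof (induction j)
      case (Suc j)
      have "m - j = Suc (m - Suc j)" using Suc.prems elim by simp
      then have "(fact (m - j) :: 'a) = (of_nat m - of_nat j) * fact (m - Suc j)"
        using Suc.prems elim by (metis fact_Suc of_nat_diff less_imp_le less_le_trans Suc_le_lessD of_nat_fact of_nat_mult)
      then show ?case using Suc by (simp add: mult_ac)
    qed simp
    from this[of k] have "fact m / (fact (m - k) * of_nat m ^ k) = (\<Prod>i<k. (of_nat m - of_nat i) / of_nat m :: 'a)"
      by (simp add: prod_dividef)
    also have "\<dots> = (\<Prod>i<k. 1 - of_nat i * (1 / of_nat m))"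
      using elim by (intro prod.cong) (auto simp: diff_divide_distrib)
    finally show ?case by simp
  qed
  ultimately show ?thesis by (simp add: tendsto_cong)
qed

theorem corollary8:
  fixes n :: nat and P :: "complex poly" and T :: "complex poly \<Rightarrow> complex poly"
  assumes "n \<ge> 1" and "P \<in> hyperbolic n" and "T \<in> mean_preservers"
  shows "poly_spectral_le n P (T P)"
proof -
  have hyp: "\<And>P n. P \<in> hyperbolic n \<Longrightarrow> T P \<in> hyperbolic n"
    and mean: "\<And>P. degree P \<ge> 1 \<Longrightarrow> zeros_mean (T P) = zeros_mean P"
    using assms(3) by (auto simp: mean_preservers_def hyperbolic_preservers_def)
  obtain a where a: "T = diff_op a" using mean_preserver_is_diff_op[OF assms(3)] .
  obtain X where X: "size X = n" "P = root_poly X" using hyperbolic_imp_root_poly[OF assms(2)] .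
  have "\<exists>B. size B = m \<and> T (monom 1 m) = root_poly B \<and> sum_mset B = 0" for m
  proof -
    obtain B where B: "size B = m" "T (monom 1 m) = root_poly B"
      using hyp[of "monom 1 m" m] root_poly_in_hyperbolic[of "replicate_mset m 0"]
        hyperbolic_imp_root_poly by (metis monom_1_eq_root_poly size_replicate_mset)
    have "sum_mset B = 0"
    proof (cases "m = 0")
      case False
      then have "zeros_mean (T (monom 1 m)) = zeros_mean (monom 1 m)"
        by (intro mean) (simp add: degree_monom_eq)
      then show ?thesis using B False by (simp add: zeros_mean_root_poly monom_1_eq_root_poly)
    qed (use B in simp)
    then show ?thesis using B by blast
  qed
  then obtain B where B: "\<And>m. size (B m) = m" "\<And>m. T (monom 1 m) = root_poly (B m)"
    "\<And>m. sum_mset (B m) = 0" by metis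
  \<comment> \<open>Division by m offsets the growth m^k of m!/(m - k)!. For m = 0 the multiset is
    empty, so dividing by 0 is harmless.\<close>
  define C where "C m = image_mset (\<lambda>\<beta>. \<beta> / real m) (B m)" for m
  define p where "p m = (\<Prod>\<beta>\<in>#C m. [:1, - complex_of_real \<beta>:])" for m
  have sum_C: "sum_mset (C m) = 0" for m
  proof -
    have "sum_mset (image_mset (\<lambda>\<beta>. \<beta> / real m) M) = sum_mset M / real m" for M
      by (induction M) (simp_all add: add_divide_distrib)
    then show ?thesis by (simp add: C_def B)
  qed
  have p_coeff: "coeff (p m) k = a k * (fact m / (fact (m - k) * of_nat m ^ k))" if "k \<le> m" for k m
  proof -
    have "(\<Prod>\<beta>\<in>#image_mset (\<lambda>\<beta>. \<beta> / real m) M. [:1, - complex_of_real \<beta>:])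
      = (\<Prod>\<beta>\<in>#M. [:1, - complex_of_real \<beta>:]) \<circ>\<^sub>p [:0, 1 / of_nat m:]" for M
      by (induction M) (simp_all add: pcompose_mult pcompose_pCons pcompose_1 del: mult_pCons_left)
    then have "p m = reflect_poly (root_poly (B m)) \<circ>\<^sub>p [:0, 1 / of_nat m:]"
      by (simp add: reflect_root_poly p_def C_def)
    then have "coeff (p m) k = (1 / of_nat m) ^ k * coeff (root_poly (B m)) (m - k)"
      using that by (simp add: coeff_pcompose_linear coeff_reflect_poly B(1))
    also have "coeff (root_poly (B m)) (m - k) = a k * fact m / fact (m - k)"
      using that by (simp add: B(2)[symmetric] a coeff_diff_op_monom)
    finally show ?thesis by (simp add: power_one_over field_simps)
  qed
  \<comment> \<open>The mean condition enters here: the accumulated shift is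
    \<open>sum_mset (C m) = 0\<close>.\<close>
  have "\<exists>Y. size Y = n \<and> diff_op (coeff (p m)) P = root_poly Y \<and> spectral_le X Y" for m
    using spectral_le_diff_op_prod[of X "C m"] by (simp add: p_def X sum_C)
  then obtain Y where Y: "\<And>m. size (Y m) = n" "\<And>m. diff_op (coeff (p m)) P = root_poly (Y m)"
    "\<And>m. spectral_le X (Y m)" by metis
  have p_lim: "(\<lambda>m. coeff (p m) k) \<longlonglongrightarrow> a k" for k
  proof -
    have "(\<lambda>m. a k * (fact m / (fact (m - k) * of_nat m ^ k))) \<longlonglongrightarrow> a k * 1"
      by (intro tendsto_intros fact_div_fact_power_tendsto)
    moreover have "\<forall>\<^sub>F m in sequentially. a k * (fact m / (fact (m - k) * of_nat m ^ k)) = coeff (p m) k"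
      using eventually_ge_at_top[of k] by eventually_elim (simp add: p_coeff)
    ultimately show ?thesis by (simp add: tendsto_cong)
  qed
  \<comment> \<open>With P fixed, only finitely many coefficients of the symbols matter, so their
    coefficientwise convergence suffices.\<close>
  have "(\<lambda>m. poly (root_poly (Y m)) z) \<longlonglongrightarrow> poly (T P) z" for z
    unfolding Y(2)[symmetric] a diff_op_def poly_sum poly_smult by (intro tendsto_intros p_lim)
  from root_poly_limit[of Y n, OF Y(1) this] obtain Z r where Z: "size Z = n" "T P = root_poly Z"
    and sums: "\<And>f :: real \<Rightarrow> real. continuous_on UNIV f \<Longrightarrow>
      (\<lambda>m. \<Sum>y\<in>#Y (r m). f y) \<longlonglongrightarrow> (\<Sum>y\<in>#Z. f y)"
    by metis
  have "spectral_le X Z"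
    unfolding spectral_le_def
  proof (intro conjI allI impI)
    show "size X = size Z" by (simp add: X Z)
    fix f :: "real \<Rightarrow> real" assume f: "convex_on UNIV f"
    then have "continuous_on UNIV f" by (intro convex_on_continuous) auto
    from sums[OF this] show "(\<Sum>x\<in>#X. f x) \<le> (\<Sum>y\<in>#Z. f y)"
      by (rule LIMSEQ_le_const) (use Y(3) f in \<open>auto simp: spectral_le_def\<close>)
  qed
  then show ?thesis using poly_spectral_le_root_poly[of X Z] X Z by simp
qed

end
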